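(* For all $x,y,z,t\in\mathbb{R}$ the equation $$\langle x,y,z,t\rangle=\langle x,y,0,t\rangle+\langle x,0,z,t\rangle+\langle 0,y,z,t\rangle-\langle x,0,0,t\rangle-\langle 0,y,0,t\rangle-\langle 0,0,z,t\rangle+\langle 0,0,0,t\rangle$$ is true in the geometric sense. That is, for every $(a,b,c)\in\mathbb{R}^3$ with $1+a+b+c=t$ (a placement of the triangle $\langle t\rangle=\langle 0,0,0,t\rangle$ in the plane), the following identity of functions on the plane holds at every point: $$F_{a+x,b+y,c+z}=F_{a+x,b+y,c}+F_{a+x,b,c+z}+F_{a,b+y,c+z}-F_{a+x,b,c}-F_{a,b+y,c}-F_{a,b,c+z}+F_{a,b,c}.$$
   Context: Fix a nondegenerate closed triangle $A_0B_0C_0$ in the Euclidean plane (not necessarily equilateral), denoted $\langle 1\rangle$, and let $\beta_A,\beta_B,\beta_C$ be the barycentric coordinates of a point of the plane with respect to $A_0,B_0,C_0$ (affine functions with $\beta_A+\beta_B+\beta_C=1$). Placed triangles. For $(a,b,c)\in\mathbb{R}^3$ put $s=1+a+b+c$ (the signed size) and $$\Delta(a,b,c)=\begin{cases}\{P:\ \beta_A(P)\ge -a,\ \beta_B(P)\ge -b,\ \beta_C(P)\ge -c\}, & s\ge 0,\\ \{P:\ \beta_A(P)< -a,\ \beta_B(P)< -b,\ \beta_C(P)< -c\}, & s<0.\end{cases}$$ For $s>0$ this is a closed triangle homothetic to $\langle1\rangle$ with ratio $s$ (or a translate of $\langle 1\rangle$ if $s=1$); for $s=0$ it is a single point; for $s<0$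 it is an open triangle, oppositely oriented, with sides parallel to those of $\langle 1\rangle$. A set $\Delta(a,b,c)$ with $1+a+b+c=t$ is a placement of the triangle $\langle t\rangle$. Let $F_{a,b,c}$ be the indicator function of $\Delta(a,b,c)$. The symbol $-\langle t\rangle$ is the "antitriangle", represented by $-F_{a,b,c}$: a triangle and an antitriangle lying exactly on one another cancel to the empty set. The symbol $\langle x,y,z,t\rangle$. If $\langle t\rangle$ is placed as $\Delta(a,b,c)$, with $t=1+a+b+c$, then $\langle x,y,z,t\rangle$ denotes $\Delta(a+x,b+y,c+z)$, i.e. the triangle of signed size $x+y+z+t$ obtained by moving the lines containing the three sides of $\langle t\rangle$ (parallel to $B_0C_0$, $C_0A_0$, $A_0B_0$ respectively) by the signed amounts $x,y,z$, measured in units in which moving one line by $x$ changes the signed size by $x$. An equation between signed triangles is true in the geometric sense if the triangle on the left side can be built from the signed triangles on the right side, i.e. overlaying them with their signs (adding the signed indicator functions pointwise) gives exactly the triangle on the left. *)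

theory Defs
  imports "HOL-Analysis.Analysis"
begin

text \<open>The three barycentric coordinates of \<open>P\<close> with respect to \<open>A0\<close>, \<open>B0\<close>, \<open>C0\<close>. The
  description is proper exactly when \<open>A0\<close>, \<open>B0\<close>, \<open>C0\<close> are not collinear.\<close>

definition barycentric ::
    "real^2 \<Rightarrow> real^2 \<Rightarrow> real^2 \<Rightarrow> real^2 \<Rightarrow> real \<times> real \<times> real" where
  "barycentric A0 B0 C0 P =
     (THE (u, v, w). u + v + w = 1 \<and> P = u *\<^sub>R A0 + v *\<^sub>R B0 + w *\<^sub>R C0)"

definition beta_A :: "real^2 \<Rightarrow> real^2 \<Rightarrow> real^2 \<Rightarrow> real^2 \<Rightarrow> real" where
  "beta_A A0 B0 C0 P = fst (barycentric A0 B0 C0 P)"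

definition beta_B :: "real^2 \<Rightarrow> real^2 \<Rightarrow> real^2 \<Rightarrow> real^2 \<Rightarrow> real" where
  "beta_B A0 B0 C0 P = fst (snd (barycentric A0 B0 C0 P))"

definition beta_C :: "real^2 \<Rightarrow> real^2 \<Rightarrow> real^2 \<Rightarrow> real^2 \<Rightarrow> real" where
  "beta_C A0 B0 C0 P = snd (snd (barycentric A0 B0 C0 P))"

text \<open>The placed triangle of signed size \<open>1 + a + b + c\<close>: closed for nonnegative size,
  open and oppositely oriented for negative size.\<close>

definition placed_triangle ::
    "real^2 \<Rightarrow> real^2 \<Rightarrow> real^2 \<Rightarrow> real \<Rightarrow> real \<Rightarrow> real \<Rightarrow> (real^2) set" where
  "placed_triangle A0 B0 C0 a b c =
     (if 1 + a + b + c \<ge> 0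
      then {P. beta_A A0 B0 C0 P \<ge> - a \<and> beta_B A0 B0 C0 P \<ge> - b \<and> beta_C A0 B0 C0 P \<ge> - c}
      else {P. beta_A A0 B0 C0 P < - a \<and> beta_B A0 B0 C0 P < - b \<and> beta_C A0 B0 C0 P < - c})"

text \<open>The triangle denoted \<open>\<langle>x, y, z, t\<rangle>\<close> once \<open>\<langle>t\<rangle>\<close> has been placed as
  \<open>placed_triangle A0 B0 C0 a b c\<close>; the size \<open>t = 1 + a + b + c\<close> is determined by the
  placement and therefore is not a separate argument.\<close>

definition moved_triangle ::
    "real^2 \<Rightarrow> real^2 \<Rightarrow> real^2 \<Rightarrow> real \<Rightarrow> real \<Rightarrow> real \<Rightarrow> real \<Rightarrow> real \<Rightarrow> real \<Rightarrow> (real^2) set" where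
  "moved_triangle A0 B0 C0 a b c x y z = placed_triangle A0 B0 C0 (a + x) (b + y) (c + z)"

end

theory Submission imports Defs begin

text \<open>
  Write \<open>u\<close>, \<open>v\<close>, \<open>w\<close> for the barycentric coordinates of a point relative to the three lines that
  bound \<open>\<Delta>(a, b, c)\<close>, that is \<open>u = \<beta>\<^sub>A + a\<close> and so on. Their sum is the signed size \<open>1 + a + b + c\<close>.
  So for nonnegative size no point of the plane has \<open>u\<close>, \<open>v\<close>, \<open>w\<close> all negative, and for negative
  size no point has all three nonnegative. The two cases in the definition of the placed triangle
  therefore merge: with \<open>p\<close>, \<open>q\<close>, \<open>r\<close> the 0-1 values of \<open>u \<ge> 0\<close>, \<open>v \<ge> 0\<close>, \<open>w \<ge> 0\<close>, its indicator is
  \<open>p q r + (1 - p) (1 - q) (1 - r) = 1 - p - q - r + p q + p r + q r\<close>, whatever the sign of the size.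

  The cubic term has cancelled. The value is a sum of functions each of which depends on at most two
  of \<open>a\<close>, \<open>b\<close>, \<open>c\<close>, since moving one line changes only one of \<open>p\<close>, \<open>q\<close>, \<open>r\<close>. The third mixed
  difference in the three displacements, which is what the equation says is zero, kills each such
  function.

  The one geometric ingredient is that the coordinates sum to 1. It rests on the
  existence and uniqueness of barycentric coordinates for a nondegenerate triangle, which make the
  definite description proper (\<open>barycentric_sum\<close>); the quadratic formula is
  \<open>indicator_placed_triangle\<close>.
\<close>

lemma barycentric_coordinates_exist:
  fixes A B C P :: "real^2"
  assumes "\<not> collinear {A, B, C}"
  obtains u v w where "u + v + w = 1" "P = u *\<^sub>R A + v *\<^sub>R B + w *\<^sub>R C"
proof -
  have distinct: "A \<noteq> B" "A \<noteq> C" "B \<noteq> C"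
    using assms by (auto simp: insert_commute)
  have "\<not> affine_dependent {A, B, C}"
    using assms distinct by (simp add: collinear_3_eq_affine_dependent)
  \<comment> \<open>Three affinely independent points in dimension two span the whole plane.\<close>
  then have "affine hull {A, B, C} = UNIV"
    using distinct by (intro affine_independent_span_eq) auto
  then have "P \<in> affine hull {A, B, C}"
    by simp
  then show thesis
    using that by (auto simp: affine_hull_3)
qed

text \<open>The difference of two coordinate triples is an affine dependency between the vertices. For
  vertices in general position only the zero dependency exists.\<close>

lemma barycentric_coordinates_unique:
  fixes A B C :: "'a::euclidean_space"
  assumes "\<not> collinear {A, B, C}"
    and "u + v + w = 1" "u' + v' + w' = 1"
    and "u *\<^sub>R A + v *\<^sub>R B + w *\<^sub>R C = u' *\<^sub>R A + v' *\<^sub>R B + w' *\<^sub>R C"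
  shows "u = u'" "v = v'" "w = w'"
proof -
  have distinct: "A \<noteq> B" "A \<noteq> C" "B \<noteq> C"
    using assms(1) by (auto simp: insert_commute)
  have indep: "\<not> affine_dependent {A, B, C}"
    using assms(1) distinct by (simp add: collinear_3_eq_affine_dependent)
  define U where "U x = (if x = A then u - u' else if x = B then v - v' else w - w')" for x
  have "sum U {A, B, C} = (u + v + w) - (u' + v' + w')"
    using distinct by (simp add: U_def)
  then have "sum U {A, B, C} = 0"
    using assms(2,3) by simp
  moreover have "(\<Sum>x\<in>{A, B, C}. U x *\<^sub>R x)
      = (u *\<^sub>R A + v *\<^sub>R B + w *\<^sub>R C) - (u' *\<^sub>R A + v' *\<^sub>R B + w' *\<^sub>R C)"
    using distinct by (simp add: U_def scaleR_left_diff_distrib)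
  then have "(\<Sum>x\<in>{A, B, C}. U x *\<^sub>R x) = 0"
    using assms(4) by simp
  ultimately have "\<forall>x\<in>{A, B, C}. U x = 0"
    using indep by (subst (asm) affine_dependent_explicit_finite) auto
  then show "u = u'" "v = v'" "w = w'"
    using distinct by (auto simp: U_def)
qed

lemma barycentric_sum:
  assumes "\<not> collinear {A0, B0, C0}"
  shows "beta_A A0 B0 C0 P + beta_B A0 B0 C0 P + beta_C A0 B0 C0 P = 1"
proof -
  obtain u v w where uvw: "u + v + w = 1" "P = u *\<^sub>R A0 + v *\<^sub>R B0 + w *\<^sub>R C0"
    using barycentric_coordinates_exist[OF assms] .
  have "barycentric A0 B0 C0 P = (u, v, w)"
    unfolding barycentric_def
  proof (rule the_equality)
    fix T
    assume "case T of (u, v, w) \<Rightarrow> u + v + w = 1 \<and> P = u *\<^sub>R A0 + v *\<^sub>R B0 + w *\<^sub>R C0"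
    then show "T = (u, v, w)"
      using uvw barycentric_coordinates_unique[OF assms, of "fst T" "fst (snd T)" "snd (snd T)" u v w]
      by (simp add: case_prod_beta prod_eq_iff)
  qed (use uvw in simp)
  then show ?thesis
    using uvw by (simp add: beta_A_def beta_B_def beta_C_def)
qed

text \<open>Since the coordinates relative to the three sides add up to the size, the patterns
  \<open>p = q = r = 1\<close> and \<open>p = q = r = 0\<close> each force the sign of the size under which the point
  belongs to the triangle. The right-hand side is 1 on exactly these two patterns and 0 on the other
  six; it has degree two because the cubic terms of \<open>p q r\<close> and \<open>(1 - p) (1 - q) (1 - r)\<close> cancel.\<close>

lemma indicator_placed_triangle:
  fixes A0 B0 C0 P :: "real^2" and a b c :: real
  assumes "\<not> collinear {A0, B0, C0}"
  defines "p \<equiv> of_bool (beta_A A0 B0 C0 P \<ge> - a)"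
    and "q \<equiv> of_bool (beta_B A0 B0 C0 P \<ge> - b)"
    and "r \<equiv> of_bool (beta_C A0 B0 C0 P \<ge> - c)"
  shows "(indicator (placed_triangle A0 B0 C0 a b c) P :: real)
    = 1 - p - q - r + p * q + p * r + q * r"
  using barycentric_sum[OF assms(1), of P]
  unfolding placed_triangle_def p_def q_def r_def
  by (cases "beta_A A0 B0 C0 P \<ge> - a"; cases "beta_B A0 B0 C0 P \<ge> - b";
      cases "beta_C A0 B0 C0 P \<ge> - c") (simp_all add: indicator_def)

theorem theorem2p4:
  fixes A0 B0 C0 :: "real^2" and x y z t :: real
  assumes nondegenerate: "\<not> collinear {A0, B0, C0}"
  shows "\<forall>a b c :: real. 1 + a + b + c = t \<longrightarrow>
    (\<forall>P :: real^2.
      (indicator (moved_triangle A0 B0 C0 a b c x y z) P :: real) =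
        indicator (moved_triangle A0 B0 C0 a b c x y 0) P
      + indicator (moved_triangle A0 B0 C0 a b c x 0 z) P
      + indicator (moved_triangle A0 B0 C0 a b c 0 y z) P
      - indicator (moved_triangle A0 B0 C0 a b c x 0 0) P
      - indicator (moved_triangle A0 B0 C0 a b c 0 y 0) P
      - indicator (moved_triangle A0 B0 C0 a b c 0 0 z) P
      + indicator (moved_triangle A0 B0 C0 a b c 0 0 0) P)"
  unfolding moved_triangle_def indicator_placed_triangle[OF nondegenerate]
  by (intro allI impI) linarith

end
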